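(* Let $\mathcal{F}$ be a minor-closed family of multigraphs. Then the limiting density of $\mathcal{F}$ is either an integer, or a superparticular ratio $i/(i+1)$ for a positive integer $i$, or unbounded (infinite).
   Context: Multigraphs are finite graphs that may have multiple edges between the same pair of vertices and any number of self-loops at a vertex. Minors of multigraphs are formed by contracting edges (without removing the resulting parallel edges or loops), deleting edges and deleting vertices. A family is minor-closed if it contains every minor of each of its members. The limiting density of $\mathcal{F}$ is $\limsup_{n\to\infty}\mathrm{ex}_{\mathcal{F}}(n)/n$, where $\mathrm{ex}_{\mathcal{F}}(n)$ is the supremum of the number of edges (counted with multiplicity, loops included) of an $n$-vertex multigraph in $\mathcal{F}$ ($0$ if none); it is unbounded if this quantity is infinite. *)

theory Defs
  imports Complex_Main "HOL-Library.Extended_Real"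
begin

text \<open>
  An edge with one end is a self-loop. The function \<open>ends\<close> is irrelevant outside \<open>edges\<close>.
\<close>

record ('v, 'e) mgraph =
  verts :: "'v set"
  edges :: "'e set"
  ends :: "'e \<Rightarrow> 'v set"

definition multigraph :: "('v, 'e) mgraph \<Rightarrow> bool" where
  "multigraph G \<longleftrightarrow> finite (verts G) \<and> finite (edges G) \<and>
     (\<forall>e \<in> edges G. ends G e \<subseteq> verts G \<and> card (ends G e) \<in> {1, 2})"

definition isomorphic :: "('v, 'e) mgraph \<Rightarrow> ('v, 'e) mgraph \<Rightarrow> bool" where
  "isomorphic G H \<longleftrightarrow> (\<exists>f g. bij_betw f (verts G) (verts H) \<and> bij_betw g (edges G) (edges H) \<and>
     (\<forall>e \<in> edges G. ends H (g e) = f ` ends G e))"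

definition delete_edge :: "('v, 'e) mgraph \<Rightarrow> 'e \<Rightarrow> ('v, 'e) mgraph" where
  "delete_edge G e = G\<lparr>edges := edges G - {e}\<rparr>"

definition delete_vertex :: "('v, 'e) mgraph \<Rightarrow> 'v \<Rightarrow> ('v, 'e) mgraph" where
  "delete_vertex G v = G\<lparr>verts := verts G - {v}, edges := {e \<in> edges G. v \<notin> ends G e}\<rparr>"

text \<open>
  The edge \<open>e\<close> disappears and its ends are merged into the vertex \<open>u\<close>, meant to be one of them.
  All other edges are kept: edges parallel to \<open>e\<close> become loops at \<open>u\<close>. Contracting a loop
  amounts to deleting it.
\<close>

definition contract_edge :: "('v, 'e) mgraph \<Rightarrow> 'e \<Rightarrow> 'v \<Rightarrow> ('v, 'e) mgraph" where
  "contract_edge G e u =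
     (let f = (\<lambda>x. if x \<in> ends G e then u else x)
      in \<lparr>verts = f ` verts G, edges = edges G - {e}, ends = (\<lambda>d. f ` ends G d)\<rparr>)"

text \<open>\<open>minor_of G H\<close>: the multigraph \<open>H\<close> is, up to isomorphism, a minor of \<open>G\<close>.\<close>

inductive minor_of :: "('v, 'e) mgraph \<Rightarrow> ('v, 'e) mgraph \<Rightarrow> bool" for G where
  refl: "minor_of G G"
| iso: "minor_of G H \<Longrightarrow> isomorphic H K \<Longrightarrow> minor_of G K"
| delete_edge: "minor_of G H \<Longrightarrow> e \<in> edges H \<Longrightarrow> minor_of G (delete_edge H e)"
| delete_vertex: "minor_of G H \<Longrightarrow> v \<in> verts H \<Longrightarrow> minor_of G (delete_vertex H v)"
| contract_edge: "minor_of G H \<Longrightarrow> e \<in> edges H \<Longrightarrow> u \<in> ends H e \<Longrightarrow>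
    minor_of G (contract_edge H e u)"

definition minor_closed :: "('v, 'e) mgraph set \<Rightarrow> bool" where
  "minor_closed F \<longleftrightarrow> (\<forall>G \<in> F. \<forall>H. minor_of G H \<longrightarrow> H \<in> F)"

text \<open>The supremum of the empty set in \<^typ>\<open>enat\<close> is \<open>0\<close>.\<close>

definition ex :: "('v, 'e) mgraph set \<Rightarrow> nat \<Rightarrow> enat" where
  "ex F n = (SUP G \<in> {G \<in> F. card (verts G) = n}. enat (card (edges G)))"

definition limiting_density :: "('v, 'e) mgraph set \<Rightarrow> ereal" where
  "limiting_density F = limsup (\<lambda>n. ereal_of_enat (ex F n) / ereal (real n))"

lemma multigraph_isomorphic:
  assumes "multigraph G" "isomorphic G H"
  shows "multigraph H"
proof -
  obtain f g where f: "bij_betw f (verts G) (verts H)" and g: "bij_betw g (edges G) (edges H)"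
    and fg: "\<forall>e \<in> edges G. ends H (g e) = f ` ends G e"
    using assms(2) unfolding isomorphic_def by blast
  have "ends H d \<subseteq> verts H \<and> card (ends H d) \<in> {1, 2}" if "d \<in> edges H" for d
  proof -
    obtain e where e: "e \<in> edges G" "d = g e"
      using \<open>d \<in> edges H\<close> g by (auto simp: bij_betw_def)
    have sub: "ends G e \<subseteq> verts G" and "card (ends G e) \<in> {1, 2}"
      using assms(1) e by (auto simp: multigraph_def)
    moreover have "card (f ` ends G e) = card (ends G e)"
      using f sub by (meson bij_betw_def card_image inj_on_subset)
    moreover have "f ` ends G e \<subseteq> verts H"
      using f sub by (auto simp: bij_betw_def)
    ultimately show ?thesis using fg e by auto
  qed
  then show ?thesis
    using assms(1) f g by (auto simp: multigraph_def bij_betw_finite)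
qed

lemma multigraph_delete_edge: "multigraph G \<Longrightarrow> multigraph (delete_edge G e)"
  by (simp add: multigraph_def delete_edge_def)

lemma multigraph_delete_vertex: "multigraph G \<Longrightarrow> multigraph (delete_vertex G v)"
  by (auto simp: multigraph_def delete_vertex_def)

lemma multigraph_contract_edge:
  assumes "multigraph G"
  shows "multigraph (contract_edge G e u)"
proof -
  define f where "f = (\<lambda>x. if x \<in> ends G e then u else x)"
  have "card (f ` ends G d) \<in> {1, 2}" if "d \<in> edges G" for d
  proof -
    have c: "card (ends G d) \<in> {1, 2}" and fin: "finite (ends G d)"
      using assms that by (auto simp: multigraph_def intro: finite_subset)
    have "card (f ` ends G d) \<le> card (ends G d)" by (rule card_image_le[OF fin])
    moreover have "card (f ` ends G d) \<noteq> 0" using c fin by auto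
    ultimately show ?thesis using c by auto
  qed
  then show ?thesis
    using assms by (auto simp: multigraph_def contract_edge_def Let_def simp flip: f_def)
qed

lemma multigraph_minor_of: "minor_of G H \<Longrightarrow> multigraph G \<Longrightarrow> multigraph H"
  by (induction rule: minor_of.induct)
    (auto intro: multigraph_isomorphic multigraph_delete_edge multigraph_delete_vertex
      multigraph_contract_edge)

end

theory Submission
  imports Defs
begin

text \<open>
  Call the number of edges of a component outside a spanning tree its excess. Contracting non-loop
  edges shrinks a component to any smaller positive number of vertices without changing its excess.
  If the density is finite, then \<open>ex F N = E\<close> is finite for some \<open>N \<ge> 1\<close>, and contracting a graph
  down to \<open>N\<close> vertices shows that, in graphs with at least \<open>N\<close> vertices, either there are at most
  \<open>N\<close> components and the total excess is at most \<open>E\<close>, or every component has excess at most \<open>E\<close>.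

  Let \<open>K\<close> be maximal such that \<open>F\<close> has graphs with arbitrarily many components of excess at least
  \<open>K\<close>. A graph with \<open>n\<close> vertices and \<open>c\<close> components then has at most \<open>n - c + K c + O(1)\<close> edges.
  If \<open>K \<ge> 1\<close> the density is \<open>K\<close>, attained by disjoint bouquets of \<open>K\<close> loops. If \<open>K = 0\<close> the bound
  is \<open>n - c + O(1)\<close>: the density is \<open>1\<close> when components are unboundedly large, and otherwise it is
  \<open>s / (s + 1)\<close>, where \<open>s + 1\<close> is the largest size that arbitrarily many components can reach
  simultaneously.
\<close>

section \<open>Components of a multigraph and contraction inside them\<close>

definition closed_set :: "('v, 'e) mgraph \<Rightarrow> 'v set \<Rightarrow> bool" where
  "closed_set G S \<longleftrightarrow> (\<forall>e \<in> edges G. ends G e \<inter> S \<noteq> {} \<longrightarrow> ends G e \<subseteq> S)"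

text \<open>Connectedness is expressed by cuts, because cuts pull back along contractions: every set of
  vertices that no edge leaves is a union of label classes.\<close>

definition component_labelling :: "('v, 'e) mgraph \<Rightarrow> ('v \<Rightarrow> 'l) \<Rightarrow> bool" where
  "component_labelling G c \<longleftrightarrow>
     (\<forall>e \<in> edges G. \<forall>x \<in> ends G e. \<forall>y \<in> ends G e. c x = c y) \<and>
     (\<forall>S x y. closed_set G S \<longrightarrow> x \<in> verts G \<longrightarrow> y \<in> verts G \<longrightarrow> c x = c y \<longrightarrow> x \<in> S \<longrightarrow> y \<in> S)"

definition comp_verts :: "('v, 'e) mgraph \<Rightarrow> ('v \<Rightarrow> 'l) \<Rightarrow> 'l \<Rightarrow> 'v set" where
  "comp_verts G c i = {v \<in> verts G. c v = i}"

definition comp_edges :: "('v, 'e) mgraph \<Rightarrow> ('v \<Rightarrow> 'l) \<Rightarrow> 'l \<Rightarrow> 'e set" where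
  "comp_edges G c i = {e \<in> edges G. c ` ends G e = {i}}"

text \<open>Each vertex is labelled by the smallest closed set containing it. Complements of closed
  sets are closed, so membership in these labels is symmetric, and equal labels mean lying in the
  same closed sets.\<close>

lemma component_labelling_exists: "\<exists>c :: 'v \<Rightarrow> 'v set. component_labelling G c"
proof
  define c where "c = (\<lambda>x. \<Inter>{S. closed_set G S \<and> x \<in> S})"
  have closed_c: "closed_set G (c x)" for x
    unfolding c_def closed_set_def by blast
  have self: "x \<in> c x" for x
    by (auto simp: c_def)
  have mono: "c y \<subseteq> c x" if "y \<in> c x" for x y
    using that closed_c[of x] by (auto simp: c_def)
  have sym: "x \<in> c y" if "y \<in> c x" for x y
  proof (rule ccontr)
    assume "x \<notin> c y"
    moreover have "closed_set G (- c y)"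
      using closed_c[of y] unfolding closed_set_def by blast
    ultimately have "c x \<subseteq> - c y"
      by (auto simp: c_def)
    then show False
      using that self by blast
  qed
  have "c x = c y" if "e \<in> edges G" "x \<in> ends G e" "y \<in> ends G e" for e x y
  proof -
    have "y \<in> c x"
      using closed_c[of x] self[of x] that unfolding closed_set_def by blast
    then show ?thesis
      using mono sym by blast
  qed
  moreover have "y \<in> S" if "closed_set G S" "c x = c y" "x \<in> S" for S x y
    using that self[of y] by (auto simp: c_def)
  ultimately show "component_labelling G c"
    unfolding component_labelling_def by blast
qed

text \<open>A component with two vertices has a non-loop edge, and contracting it costs one vertex
  and one edge, so the excess stays. As the merged vertex keeps the name of an end, \<open>c\<close>
  itself still labels the contracted graph.\<close>

lemma component_labelling_contract_step:
  assumes G: "multigraph G" and c: "component_labelling G c"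
    and i: "card (comp_verts G c i) \<ge> 2"
  obtains e u v where "e \<in> edges G" "u \<in> ends G e" "v \<in> verts G" "c v = i" "c ` ends G e = {i}"
    "component_labelling (contract_edge G e u) c"
    "verts (contract_edge G e u) = verts G - {v}"
    "\<And>j. comp_edges (contract_edge G e u) c j = comp_edges G c j - {e}"
    "\<And>j. comp_verts (contract_edge G e u) c j = comp_verts G c j - {v}"
proof -
  obtain x y where xy: "x \<in> verts G" "y \<in> verts G" "c x = i" "c y = i" "x \<noteq> y"
  proof -
    from i obtain T where "T \<subseteq> comp_verts G c i" "card T = 2"
      by (meson obtain_subset_with_card_n)
    then show ?thesis
      by (auto simp: card_2_iff comp_verts_def intro: that)
  qed
  \<comment> \<open>A closed \<open>{x}\<close> would also contain \<open>y\<close>, which has the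
    same label.\<close>
  have "\<not> closed_set G {x}"
    using c xy unfolding component_labelling_def by (metis singletonD singletonI)
  then obtain e where e: "e \<in> edges G" "x \<in> ends G e" "\<not> ends G e \<subseteq> {x}"
    unfolding closed_set_def by auto
  then obtain v where v: "v \<in> ends G e" "v \<noteq> x"
    by blast
  have "card (ends G e) \<in> {1, 2}" and sub: "ends G e \<subseteq> verts G"
    using G e by (auto simp: multigraph_def)
  then have ends: "ends G e = {x, v}"
    using e v by (auto simp: card_1_singleton_iff card_2_iff)
  have cv: "c v = i"
    using c e v xy unfolding component_labelling_def by metis
  define f where "f = (\<lambda>z. if z \<in> ends G e then x else z)"
  have cf: "c (f z) = c z" for z
    using cv xy(3) ends by (auto simp: f_def)
  have fv: "f z = z" if "z \<noteq> v" for z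
    using that ends by (auto simp: f_def)
  have fvx: "f v = x"
    using ends by (auto simp: f_def)
  define H where "H = contract_edge G e x"
  have H: "verts H = f ` verts G" "edges H = edges G - {e}" "\<And>d. ends H d = f ` ends G d"
    by (simp_all add: H_def contract_edge_def Let_def f_def)
  have vH: "verts H = verts G - {v}"
  proof
    show "verts H \<subseteq> verts G - {v}"
      using xy(1) v ends by (auto simp: H f_def)
    show "verts G - {v} \<subseteq> verts H"
    proof
      fix z assume "z \<in> verts G - {v}"
      then show "z \<in> verts H"
        using fv[of z] H(1) by (metis Diff_iff image_eqI singletonI)
    qed
  qed
  have "component_labelling H c"
    unfolding component_labelling_def
  proof (intro conjI allI impI ballI)
    fix d a b assume "d \<in> edges H" "a \<in> ends H d" "b \<in> ends H d"
    then obtain a' b' where "d \<in> edges G" "a' \<in> ends G d" "b' \<in> ends G d" "a = f a'" "b = f b'"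
      using H by auto
    then show "c a = c b"
      using c cf unfolding component_labelling_def by metis
  next
    fix S a b assume S: "closed_set H S" and ab: "a \<in> verts H" "b \<in> verts H" "c a = c b" "a \<in> S"
    have "closed_set G (f -` S)"
      unfolding closed_set_def
    proof (intro ballI impI)
      fix d assume d: "d \<in> edges G" "ends G d \<inter> f -` S \<noteq> {}"
      show "ends G d \<subseteq> f -` S"
      \<comment> \<open>The contracted edge is absent from \<open>H\<close>, but \<open>f\<close>
        sends all its ends to \<open>x\<close>, so the preimage contains all of them or
        none.\<close>
      proof (cases "d = e")
        case True
        then show ?thesis using d by (auto simp: f_def)
      next
        case False
        then have "d \<in> edges H" "ends H d \<inter> S \<noteq> {}"
          using d H by auto
        then have "ends H d \<subseteq> S"
          using S by (auto simp: closed_set_def)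
        then show ?thesis
          using H by auto
      qed
    qed
    moreover have "a \<in> verts G" "b \<in> verts G" "f a = a" "f b = b"
      using ab vH fv by auto
    ultimately have "b \<in> f -` S"
      using c ab unfolding component_labelling_def by blast
    then show "b \<in> S"
      using \<open>f b = b\<close> by simp
  qed
  moreover have "comp_edges H c j = comp_edges G c j - {e}" for j
    by (auto simp: comp_edges_def H image_image cf)
  moreover have "comp_verts H c j = comp_verts G c j - {v}" for j
    by (auto simp: comp_verts_def vH)
  ultimately show ?thesis
    using that[of e x v] e v sub cv xy ends vH by (auto simp: H_def)
qed

lemma finite_comp:
  assumes "multigraph G"
  shows "finite (comp_verts G c i)" "finite (comp_edges G c i)"
  using assms by (auto simp: multigraph_def comp_verts_def comp_edges_def)

text \<open>Contracting until fewer than two vertices remain removes as many edges as vertices. This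
  makes the excess a natural number.\<close>

lemma card_comp_verts_le:
  assumes "multigraph G" "component_labelling G c"
  shows "card (comp_verts G c i) \<le> card (comp_edges G c i) + 1"
  using assms
proof (induction "card (verts G)" arbitrary: G rule: less_induct)
  case less
  show ?case
  proof (cases "card (comp_verts G c i) \<ge> 2")
    case True
    obtain e u v where *: "e \<in> edges G" "u \<in> ends G e" "v \<in> verts G" "c v = i" "c ` ends G e = {i}"
      "component_labelling (contract_edge G e u) c"
      "verts (contract_edge G e u) = verts G - {v}"
      "\<And>j. comp_edges (contract_edge G e u) c j = comp_edges G c j - {e}"
      "\<And>j. comp_verts (contract_edge G e u) c j = comp_verts G c j - {v}"
      using component_labelling_contract_step[OF less.prems True] by blast
    have "card (verts G - {v}) < card (verts G)"
      using * less.prems by (intro card_Diff1_less) (auto simp: multigraph_def)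
    then have "card (comp_verts G c i - {v}) \<le> card (comp_edges G c i - {e}) + 1"
      using less.hyps[of "contract_edge G e u"] * multigraph_contract_edge less.prems by metis
    moreover have "v \<in> comp_verts G c i" "e \<in> comp_edges G c i"
      using * by (auto simp: comp_verts_def comp_edges_def)
    ultimately show ?thesis
      using finite_comp[OF less.prems(1), of c i]
      by (metis Suc_eq_plus1 add_le_cancel_right card_Suc_Diff1)
  qed simp
qed

section \<open>Counting vertices and edges by components\<close>

lemma card_verts_sum:
  assumes "multigraph G"
  shows "card (verts G) = (\<Sum>i \<in> c ` verts G. card (comp_verts G c i))"
proof -
  have "card (\<Union>i \<in> c ` verts G. comp_verts G c i) = (\<Sum>i \<in> c ` verts G. card (comp_verts G c i))"
    using assms finite_comp[OF assms]
    by (intro card_UN_disjoint) (auto simp: comp_verts_def multigraph_def)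
  moreover have "(\<Union>i \<in> c ` verts G. comp_verts G c i) = verts G"
    by (auto simp: comp_verts_def)
  ultimately show ?thesis by simp
qed

lemma card_edges_sum:
  assumes "multigraph G" "component_labelling G c"
  shows "card (edges G) = (\<Sum>i \<in> c ` verts G. card (comp_edges G c i))"
proof -
  have "card (\<Union>i \<in> c ` verts G. comp_edges G c i) = (\<Sum>i \<in> c ` verts G. card (comp_edges G c i))"
    using assms finite_comp[OF assms(1)]
    by (intro card_UN_disjoint) (auto simp: comp_edges_def multigraph_def)
  moreover have "e \<in> (\<Union>i \<in> c ` verts G. comp_edges G c i)" if e: "e \<in> edges G" for e
  proof -
    have "card (ends G e) \<in> {1, 2}" "ends G e \<subseteq> verts G"
      using assms e by (auto simp: multigraph_def)
    then obtain x where x: "x \<in> ends G e" "x \<in> verts G"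
      by (cases "ends G e = {}") auto
    then have "c ` ends G e = {c x}"
      using assms e unfolding component_labelling_def by blast
    then show ?thesis
      using e x by (auto simp: comp_edges_def)
  qed
  then have "(\<Union>i \<in> c ` verts G. comp_edges G c i) = edges G"
    by (auto simp: comp_edges_def)
  ultimately show ?thesis by simp
qed

section \<open>Limiting density from linear bounds\<close>

text \<open>Additive constants vanish after division by \<open>n\<close>. Since the density is a
  limsup, the lower bound is required only for arbitrarily large \<open>n\<close>.\<close>

lemma limiting_density_eqI:
  assumes upper: "\<And>G. G \<in> F \<Longrightarrow> N \<le> card (verts G) \<Longrightarrow>
      real (card (edges G)) \<le> a * real (card (verts G)) + C"
    and lower: "\<And>q. \<exists>n\<ge>q. \<exists>m. enat m \<le> ex F n \<and> a * real n - C' \<le> real m"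
    and nonneg: "a \<ge> 0" "C \<ge> 0"
  shows "limiting_density F = ereal a"
proof (rule antisym)
  have "ereal_of_enat (ex F n) / ereal (real n) \<le> ereal (a + C / real n)" if n: "n \<ge> max N 1" for n
  proof -
    have "ex F n \<le> enat (nat \<lfloor>a * real n + C\<rfloor>)"
      unfolding ex_def using upper n by (intro SUP_least) (auto simp: le_nat_floor)
    then have "ereal_of_enat (ex F n) \<le> ereal (real (nat \<lfloor>a * real n + C\<rfloor>))"
      by (metis ereal_of_enat_le_iff ereal_of_enat_simps(1))
    also have "\<dots> \<le> ereal (a * real n + C)"
      using nonneg by simp
    finally have "ereal_of_enat (ex F n) / ereal (real n) \<le> ereal (a * real n + C) / ereal (real n)"
      using n by (intro ereal_divide_right_mono) auto
    also have "\<dots> = ereal (a + C / real n)"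
      using n by (simp add: field_simps)
    finally show ?thesis .
  qed
  then have "\<forall>\<^sub>F n in sequentially. ereal_of_enat (ex F n) / ereal (real n) \<le> ereal (a + C / real n)"
    using eventually_ge_at_top by (rule eventually_mono[rotated])
  then have "limiting_density F \<le> limsup (\<lambda>n. ereal (a + C / real n))"
    unfolding limiting_density_def by (rule Limsup_mono)
  also have "\<dots> = ereal a"
  proof (rule lim_imp_Limsup)
    have "(\<lambda>n. a + C / real n) \<longlonglongrightarrow> a + 0"
      by (intro tendsto_add tendsto_const lim_const_over_n)
    then show "(\<lambda>n. ereal (a + C / real n)) \<longlonglongrightarrow> ereal a"
      by simp
  qed simp
  finally show "limiting_density F \<le> ereal a" .
  show "ereal a \<le> limiting_density F"
  proof (rule ccontr)
    assume "\<not> ereal a \<le> limiting_density F"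
    \<comment> \<open>Once \<open>C' / real n\<close> drops below \<open>a - b\<close>, the lower
      bound pushes the ratio above \<open>b\<close>.\<close>
    then obtain b where b: "limiting_density F < ereal b" "b < a"
      using ereal_dense2 by (metis ereal_less_eq(3) not_le less_ereal.simps(1))
    have "\<forall>\<^sub>F n in sequentially. ereal_of_enat (ex F n) / ereal (real n) < ereal b"
      using b(1) unfolding limiting_density_def by (rule Limsup_lessD)
    moreover have "\<forall>\<^sub>F n in sequentially. C' / real n < a - b"
      using lim_const_over_n[of C'] b(2) by (intro order_tendstoD(2)) auto
    moreover have "\<forall>\<^sub>F n :: nat in sequentially. n \<ge> 1"
      by (rule eventually_ge_at_top)
    ultimately have "\<forall>\<^sub>F n in sequentially. ereal_of_enat (ex F n) / ereal (real n) < ereal b \<and>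
        C' / real n < a - b \<and> n \<ge> 1"
      by eventually_elim simp
    then obtain q where q: "\<And>n. n \<ge> q \<Longrightarrow> ereal_of_enat (ex F n) / ereal (real n) < ereal b \<and>
        C' / real n < a - b \<and> n \<ge> 1"
      unfolding eventually_sequentially by blast
    obtain n m where nm: "n \<ge> q" "enat m \<le> ex F n" "a * real n - C' \<le> real m"
      using lower by blast
    then have n: "ereal_of_enat (ex F n) / ereal (real n) < ereal b" "C' / real n < a - b" "n \<ge> 1"
      using q by auto
    have "ereal (real m) \<le> ereal_of_enat (ex F n)"
      using nm(2) by (metis ereal_of_enat_le_iff ereal_of_enat_simps(1))
    then have "ereal (real m) / ereal (real n) \<le> ereal_of_enat (ex F n) / ereal (real n)"
      using n by (intro ereal_divide_right_mono) auto
    then have "ereal (real m) / ereal (real n) < ereal b"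
      using n(1) by (rule le_less_trans)
    then have "real m / real n < b"
      using n(3) by simp
    moreover have "a - C' / real n \<le> real m / real n"
      using divide_right_mono[OF nm(3), of "real n"] n(3) by (simp add: diff_divide_distrib)
    ultimately show False
      using n(2) by linarith
  qed
qed

lemma finite_limiting_density_ex:
  assumes "limiting_density F \<noteq> \<infinity>"
  obtains N E where "N \<ge> 1" "ex F N \<le> enat E"
proof -
  have "limiting_density F < \<infinity>"
    using assms by simp
  then obtain b where "limiting_density F < ereal b"
    using ereal_dense2 by blast
  then have "\<forall>\<^sub>F n in sequentially. ereal_of_enat (ex F n) / ereal (real n) < ereal b"
    unfolding limiting_density_def by (rule Limsup_lessD)
  then obtain q where q: "\<And>n. n \<ge> q \<Longrightarrow> ereal_of_enat (ex F n) / ereal (real n) < ereal b"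
    unfolding eventually_sequentially by blast
  \<comment> \<open>\<open>Suc q\<close> instead of \<open>q\<close> secures
    \<open>N \<ge> 1\<close>.\<close>
  have "ex F (Suc q) \<noteq> \<infinity>"
    using q[of "Suc q"] by (intro notI) simp
  then obtain E where "ex F (Suc q) = enat E"
    by blast
  then show ?thesis
    by (intro that[of "Suc q" E]) auto
qed

section \<open>Two facts on sums of natural numbers\<close>

text \<open>Starting from all ones, summands are raised one unit at a time. This provides component
  sizes with total exactly \<open>N\<close> for a contraction.\<close>

lemma exists_bounded_sum:
  fixes n :: "'a \<Rightarrow> nat"
  assumes "finite I" "\<And>i. i \<in> I \<Longrightarrow> 1 \<le> n i" "card I \<le> N" "N \<le> (\<Sum>i\<in>I. n i)"
  shows "\<exists>t. (\<forall>i\<in>I. 1 \<le> t i \<and> t i \<le> n i) \<and> (\<Sum>i\<in>I. t i) = N"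
  using assms(3,4)
proof (induction N rule: dec_induct)
  case base
  then show ?case
    using assms(2) by (intro exI[of _ "\<lambda>_. 1"]) auto
next
  case (step N)
  then obtain t where t: "\<forall>i\<in>I. 1 \<le> t i \<and> t i \<le> n i" "(\<Sum>i\<in>I. t i) = N"
    by auto
  have "\<exists>i\<in>I. t i < n i"
    using step.prems t(2) by (metis Suc_n_not_le_n leI order_trans sum_mono)
  then obtain i where i: "i \<in> I" "t i < n i"
    by blast
  have "(\<Sum>j\<in>I. (t(i := Suc (t i))) j) = Suc N"
    using i assms(1) t(2) by (simp add: sum.remove[of I i])
  then show ?case
    using i t(1) by (intro exI[of _ "t(i := Suc (t i))"]) auto
qed

lemma sum_le_few_exceptions:
  fixes f :: "'a \<Rightarrow> nat"
  assumes "finite I" "\<And>i. i \<in> I \<Longrightarrow> f i \<le> R" "card {i\<in>I. K < f i} \<le> p"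
  shows "(\<Sum>i\<in>I. f i) \<le> K * card I + p * R"
proof -
  have "(\<Sum>i\<in>I. f i) \<le> (\<Sum>i\<in>I. K + (if K < f i then R else 0))"
    using assms(2) by (intro sum_mono) (auto intro: trans_le_add2)
  also have "\<dots> = K * card I + card {i\<in>I. K < f i} * R"
    using assms(1) by (simp add: sum.distrib sum.If_cases Int_def)
  also have "\<dots> \<le> K * card I + p * R"
    using assms(3) by simp
  finally show ?thesis .
qed

text \<open>The excess \<open>l i\<close> of a component is its number of edges outside a spanning tree. It is the
  invariant of contractions.\<close>

definition profile :: "('v, 'e) mgraph set \<Rightarrow> 'v set set \<Rightarrow> ('v set \<Rightarrow> nat) \<Rightarrow> ('v set \<Rightarrow> nat) \<Rightarrow> bool" where
  "profile F I n l \<longleftrightarrow> (\<exists>G \<in> F. \<exists>c. component_labelling G c \<and> c ` verts G = I \<and>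
     (\<forall>i \<in> I. card (comp_verts G c i) = n i \<and> card (comp_edges G c i) + 1 = n i + l i))"

section \<open>Profiles of members of a minor-closed family\<close>

locale minor_closed_family =
  fixes F :: "('v, 'e) mgraph set"
  assumes multi: "G \<in> F \<Longrightarrow> multigraph G"
    and closed: "minor_closed F"
begin

lemma minor_in: "G \<in> F \<Longrightarrow> minor_of G H \<Longrightarrow> H \<in> F"
  using closed by (simp add: minor_closed_def)

lemma contract_edge_in: "G \<in> F \<Longrightarrow> e \<in> edges G \<Longrightarrow> u \<in> ends G e \<Longrightarrow> contract_edge G e u \<in> F"
  by (erule minor_in) (intro minor_of.contract_edge minor_of.refl)

lemma delete_vertex_in: "G \<in> F \<Longrightarrow> v \<in> verts G \<Longrightarrow> delete_vertex G v \<in> F"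
  by (erule minor_in) (intro minor_of.delete_vertex minor_of.refl)

lemma profile_finite: "profile F I n l \<Longrightarrow> finite I"
  using multi by (auto simp: profile_def multigraph_def)

lemma profile_pos:
  assumes "profile F I n l" "i \<in> I"
  shows "n i \<ge> 1"
proof -
  obtain G c where G: "G \<in> F" "c ` verts G = I" "card (comp_verts G c i) = n i"
    using assms by (auto simp: profile_def)
  then have "comp_verts G c i \<noteq> {}"
    using assms(2) by (auto simp: comp_verts_def)
  then show ?thesis
    using G finite_comp[OF multi[OF G(1)]] by (metis One_nat_def Suc_leI card_gt_0_iff)
qed

text \<open>The defining equation of the excess is summed over the components. It is kept additive
  because natural subtraction truncates.\<close>

lemma profile_exists:
  assumes "G \<in> F"
  obtains I n l where "profile F I n l" "card (verts G) = (\<Sum>i\<in>I. n i)"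
    "card (edges G) + card I = (\<Sum>i\<in>I. n i) + (\<Sum>i\<in>I. l i)"
proof -
  note m = multi[OF assms]
  obtain c :: "'v \<Rightarrow> 'v set" where c: "component_labelling G c"
    using component_labelling_exists by blast
  let ?I = "c ` verts G" and ?n = "\<lambda>i. card (comp_verts G c i)"
  \<comment> \<open>This subtraction does not truncate, by
    \<open>card_comp_verts_le\<close>.\<close>
  let ?l = "\<lambda>i. card (comp_edges G c i) + 1 - ?n i"
  have l: "card (comp_edges G c i) + 1 = ?n i + ?l i" for i
    using card_comp_verts_le[OF m c, of i] by simp
  have "profile F ?I ?n ?l"
    unfolding profile_def using assms c l by blast
  moreover have "card (edges G) + card ?I = (\<Sum>i\<in>?I. ?n i) + (\<Sum>i\<in>?I. ?l i)"
  proof -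
    have "card (edges G) + card ?I = (\<Sum>i\<in>?I. card (comp_edges G c i) + 1)"
      by (simp add: card_edges_sum[OF m c] sum_Suc)
    also have "\<dots> = (\<Sum>i\<in>?I. ?n i + ?l i)"
      using l by presburger
    finally show ?thesis by (simp add: sum.distrib)
  qed
  ultimately show ?thesis
    using that card_verts_sum[OF m] by blast
qed

lemma profile_ex:
  assumes "profile F I n l" "m + card I \<le> (\<Sum>i\<in>I. n i) + (\<Sum>i\<in>I. l i)"
  shows "enat m \<le> ex F (\<Sum>i\<in>I. n i)"
proof -
  obtain G c where G: "G \<in> F" "component_labelling G c" "c ` verts G = I"
    "\<forall>i \<in> I. card (comp_verts G c i) = n i \<and> card (comp_edges G c i) + 1 = n i + l i"
    using assms(1) by (auto simp: profile_def)
  note m = multi[OF G(1)]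
  have "card (verts G) = (\<Sum>i\<in>I. n i)"
    using card_verts_sum[OF m, of c] G by simp
  moreover have "card (edges G) + card I = (\<Sum>i\<in>I. n i) + (\<Sum>i\<in>I. l i)"
  proof -
    have "card (edges G) + card I = (\<Sum>i\<in>I. card (comp_edges G c i) + 1)"
      unfolding card_edges_sum[OF m G(2)] G(3) by (simp add: sum_Suc)
    also have "\<dots> = (\<Sum>i\<in>I. n i + l i)"
      using G(4) by (intro sum.cong) auto
    finally show ?thesis
      by (simp add: sum.distrib)
  qed
  ultimately have "G \<in> {G \<in> F. card (verts G) = (\<Sum>i\<in>I. n i)}" "m \<le> card (edges G)"
    using G assms(2) by auto
  then show ?thesis
    unfolding ex_def by (meson SUP_upper2 enat_ord_simps(1))
qed

text \<open>While some component exceeds its target size, one of its non-loop edges is contracted,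
  which lowers its size by one and preserves every excess.\<close>

lemma profile_contract:
  assumes "profile F I n l" "\<And>i. i \<in> I \<Longrightarrow> 1 \<le> t i \<and> t i \<le> n i"
  shows "profile F I t l"
  using assms
proof (induction "\<Sum>i\<in>I. n i" arbitrary: n rule: less_induct)
  case less
  show ?case
  proof (cases "\<forall>i\<in>I. t i = n i")
    case True
    then show ?thesis
      using less.prems(1) unfolding profile_def by (metis (no_types, lifting))
  next
    case False
    then obtain i where i: "i \<in> I" "t i < n i"
      using less.prems(2) by force
    obtain G c where G: "G \<in> F" "component_labelling G c" "c ` verts G = I"
      "\<forall>i \<in> I. card (comp_verts G c i) = n i \<and> card (comp_edges G c i) + 1 = n i + l i"
      using less.prems(1) by (auto simp: profile_def)
    note m = multi[OF G(1)]
    have two: "card (comp_verts G c i) \<ge> 2"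
      using G i less.prems(2)[of i] by auto
    obtain e u v where *: "e \<in> edges G" "u \<in> ends G e" "v \<in> verts G" "c v = i" "c ` ends G e = {i}"
      "component_labelling (contract_edge G e u) c"
      "verts (contract_edge G e u) = verts G - {v}"
      "\<And>j. comp_edges (contract_edge G e u) c j = comp_edges G c j - {e}"
      "\<And>j. comp_verts (contract_edge G e u) c j = comp_verts G c j - {v}"
      using component_labelling_contract_step[OF m G(2) two] by blast
    let ?H = "contract_edge G e u" and ?n = "n(i := n i - 1)"
    have in_comp: "v \<in> comp_verts G c i" "e \<in> comp_edges G c i"
      using * by (auto simp: comp_verts_def comp_edges_def)
    \<comment> \<open>A second vertex of component \<open>i\<close> survives, so the label
      \<open>i\<close> stays in use.\<close>
    have "card (comp_verts G c i - {v}) \<noteq> 0"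
      using two in_comp finite_comp[OF m] by (simp add: card_Diff_singleton)
    then have "comp_verts G c i - {v} \<noteq> {}"
      by (metis card.empty)
    then obtain w where "w \<in> verts G" "w \<noteq> v" "c w = i"
      by (auto simp: comp_verts_def)
    then have "c ` verts ?H = I"
      using * G(3) by auto
    moreover have "card (comp_verts ?H c j) = ?n j \<and> card (comp_edges ?H c j) + 1 = ?n j + l j"
      if j: "j \<in> I" for j
    proof (cases "j = i")
      case True
      have "card (comp_edges G c i) \<ge> 1"
        using in_comp finite_comp[OF m] by (metis One_nat_def Suc_leI card_gt_0_iff empty_iff)
      then show ?thesis
        using True G(4) i(1) two in_comp finite_comp[OF m] unfolding *(8,9)
        by (auto simp: card_Diff_singleton)
    next
      case False
      then have "v \<notin> comp_verts G c j" "e \<notin> comp_edges G c j"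
        using * by (auto simp: comp_verts_def comp_edges_def)
      then show ?thesis
        using False G(4) j unfolding *(8,9) by simp
    qed
    ultimately have "profile F I ?n l"
      unfolding profile_def using contract_edge_in[OF G(1) *(1,2)] *(6) by blast
    moreover have "sum ?n I < sum n I"
      using i profile_finite[OF less.prems(1)] by (intro sum_strict_mono_ex1) auto
    moreover have "1 \<le> t j \<and> t j \<le> ?n j" if "j \<in> I" for j
      using less.prems(2)[OF that] i by auto
    ultimately show ?thesis
      using less.hyps by blast
  qed
qed

lemma delete_vertices_in:
  assumes "G \<in> F" "finite D" "D \<subseteq> verts G"
  shows "G\<lparr>verts := verts G - D, edges := {e \<in> edges G. ends G e \<inter> D = {}}\<rparr> \<in> F"
  using assms(2,3)
proof (induction D rule: finite_induct)
  case empty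
  then show ?case using assms by simp
next
  case (insert v D)
  let ?H = "G\<lparr>verts := verts G - D, edges := {e \<in> edges G. ends G e \<inter> D = {}}\<rparr>"
  have "delete_vertex ?H v \<in> F"
    using insert by (intro delete_vertex_in) auto
  moreover have "delete_vertex ?H v =
    G\<lparr>verts := verts G - insert v D, edges := {e \<in> edges G. ends G e \<inter> insert v D = {}}\<rparr>"
    by (auto simp: delete_vertex_def intro!: mgraph.equality)
  ultimately show ?case by simp
qed

text \<open>Deleting all vertices of the unwanted components leaves the others intact.\<close>

lemma profile_restrict:
  assumes "profile F I n l" "J \<subseteq> I"
  shows "profile F J n l"
proof -
  obtain G c where G: "G \<in> F" "component_labelling G c" "c ` verts G = I"
    "\<forall>i \<in> I. card (comp_verts G c i) = n i \<and> card (comp_edges G c i) + 1 = n i + l i"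
    using assms(1) by (auto simp: profile_def)
  define D where "D = {v \<in> verts G. c v \<notin> J}"
  define H where "H = G\<lparr>verts := verts G - D, edges := {e \<in> edges G. ends G e \<inter> D = {}}\<rparr>"
  have "finite D"
    using multi[OF G(1)] by (auto simp: D_def multigraph_def)
  then have HF: "H \<in> F"
    unfolding H_def using G by (intro delete_vertices_in) (auto simp: D_def)
  have edges_c: "c x = c y" if "e \<in> edges G" "x \<in> ends G e" "y \<in> ends G e" for e x y
    using G(2) that unfolding component_labelling_def by blast
  have "component_labelling H c"
    unfolding component_labelling_def
  proof (intro conjI allI impI ballI)
    fix e x y assume "e \<in> edges H" "x \<in> ends H e" "y \<in> ends H e"
    then show "c x = c y" using edges_c by (auto simp: H_def)
  next
    fix S x y
    assume S: "closed_set H S" and xy: "x \<in> verts H" "y \<in> verts H" "c x = c y" "x \<in> S"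
    \<comment> \<open>\<open>S\<close> may contain vertices outside \<open>H\<close>, so it is cut
      down to labels in \<open>J\<close>. An edge meeting the result has only such labels and
      therefore survives in \<open>H\<close>.\<close>
    have "closed_set G (S \<inter> {v. c v \<in> J})"
      unfolding closed_set_def
    proof (intro ballI impI)
      fix e assume e: "e \<in> edges G" "ends G e \<inter> (S \<inter> {v. c v \<in> J}) \<noteq> {}"
      then have J: "\<forall>v \<in> ends G e. c v \<in> J"
      proof -
        from e(2) obtain w where "w \<in> ends G e" "c w \<in> J"
          by blast
        then show ?thesis
          using edges_c[OF e(1)] by metis
      qed
      then have "e \<in> edges H"
        using e by (auto simp: H_def D_def)
      then have "ends G e \<subseteq> S"
        using S e unfolding closed_set_def by (auto simp: H_def)
      then show "ends G e \<subseteq> S \<inter> {v. c v \<in> J}"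
        using J by auto
    qed
    moreover have "x \<in> verts G" "y \<in> verts G" "c x \<in> J"
      using xy by (auto simp: H_def D_def)
    ultimately show "y \<in> S"
      using G(2) xy unfolding component_labelling_def by blast
  qed
  moreover have "c ` verts H = J"
    using assms(2) G(3) by (auto simp: H_def D_def)
  moreover have "comp_verts H c j = comp_verts G c j" "comp_edges H c j = comp_edges G c j"
    if "j \<in> J" for j
    using that by (auto simp: comp_verts_def comp_edges_def H_def D_def)
  ultimately show ?thesis
    using HF G(4) assms(2) unfolding profile_def by (metis (no_types, lifting) subsetD)
qed

text \<open>Once each kept component is contracted to a single vertex, exactly its excess remains,
  as loops.\<close>

lemma profile_bouquets:
  assumes "profile F I n l" "J \<subseteq> I"
  shows "enat (\<Sum>j\<in>J. l j) \<le> ex F (card J)"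
proof -
  have J: "profile F J n l"
    using profile_restrict[OF assms] .
  then have "profile F J (\<lambda>_. 1) l"
    by (rule profile_contract) (use profile_pos[OF J] in auto)
  from profile_ex[OF this, of "\<Sum>j\<in>J. l j"] show ?thesis
    by simp
qed

section \<open>Bounding the total excess\<close>

text \<open>With at most \<open>N\<close> components, contraction to exactly \<open>N\<close>
  vertices bounds the total excess by \<open>E\<close>. With more, contracting \<open>N\<close> of
  them to points bounds every single excess by \<open>E\<close>, and fewer than \<open>p\<close>
  components have excess above \<open>K\<close>. The factor \<open>p + 1\<close> covers both
  cases.\<close>

lemma excess_bound:
  assumes "N \<ge> 1" and E: "ex F N \<le> enat E"
    and few: "\<And>I n l. profile F I n l \<Longrightarrow> \<forall>i\<in>I. Suc K \<le> l i \<Longrightarrow> card I < p"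
    and prof: "profile F I n l" and large: "N \<le> (\<Sum>i\<in>I. n i)"
  shows "(\<Sum>i\<in>I. l i) \<le> K * card I + (p + 1) * E"
proof (cases "card I \<le> N")
  case True
  note fin = profile_finite[OF prof] and pos = profile_pos[OF prof]
  obtain t where t: "\<forall>i\<in>I. 1 \<le> t i \<and> t i \<le> n i" "(\<Sum>i\<in>I. t i) = N"
    using exists_bounded_sum[OF fin pos True large] by blast
  then have "profile F I t l"
    using profile_contract[OF prof] by blast
  then have "enat (\<Sum>i\<in>I. l i) \<le> ex F N"
    using profile_ex[of I t l "\<Sum>i\<in>I. l i"] t(2) True by simp
  then have "(\<Sum>i\<in>I. l i) \<le> E"
    using E by (meson enat_ord_simps(1) order_trans)
  then show ?thesis
    by (simp add: trans_le_add2 trans_le_add1)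
next
  case False
  note fin = profile_finite[OF prof]
  have "l i \<le> E" if "i \<in> I" for i
  proof -
    have "N - 1 \<le> card (I - {i})"
      using False that fin by (simp add: card_Diff_singleton)
    \<comment> \<open>Together with \<open>i\<close> these make exactly \<open>N\<close> components,
      so the bound on \<open>ex F N\<close> applies.\<close>
    then obtain J where J: "J \<subseteq> I - {i}" "card J = N - 1" "finite J"
      by (meson obtain_subset_with_card_n)
    then have "card (insert i J) = N"
      using \<open>N \<ge> 1\<close> by (subst card_insert_disjoint) auto
    then have "enat (\<Sum>j\<in>insert i J. l j) \<le> ex F N"
      using profile_bouquets[OF prof, of "insert i J"] J that by auto
    then have "enat (\<Sum>j\<in>insert i J. l j) \<le> enat E"
      using E by (rule order_trans)
    moreover have "l i \<le> (\<Sum>j\<in>insert i J. l j)"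
      using J by (intro member_le_sum) auto
    ultimately show ?thesis by simp
  qed
  moreover have "card {i\<in>I. K < l i} < p"
    using profile_restrict[OF prof, of "{i\<in>I. K < l i}"] few by auto
  ultimately have "(\<Sum>i\<in>I. l i) \<le> K * card I + p * E"
    using sum_le_few_exceptions[OF fin] by simp
  then show ?thesis by simp
qed

section \<open>Many components of large excess or large size\<close>

text \<open>Imposing the bound on all components of the graph is harmless, since
  \<open>profile_restrict\<close> discards the others.\<close>

definition many_of_excess :: "nat \<Rightarrow> bool" where
  "many_of_excess K \<longleftrightarrow> (\<forall>p. \<exists>I n l. profile F I n l \<and> p \<le> card I \<and> (\<forall>i\<in>I. K \<le> l i))"

text \<open>The index \<open>s\<close> counts the edges of a spanning tree on \<open>s + 1\<close>
  vertices, which makes it the numerator of the density.\<close>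

definition many_of_size :: "nat \<Rightarrow> bool" where
  "many_of_size s \<longleftrightarrow> (\<forall>p. \<exists>I n l. profile F I n l \<and> p \<le> card I \<and> (\<forall>i\<in>I. s + 1 \<le> n i))"

lemma not_many_of_excess:
  assumes "\<not> many_of_excess K"
  obtains p where "\<And>I n l. profile F I n l \<Longrightarrow> \<forall>i\<in>I. K \<le> l i \<Longrightarrow> card I < p"
  using assms unfolding many_of_excess_def not_ex not_all de_Morgan_conj not_le by blast

lemma not_many_of_size:
  assumes "\<not> many_of_size s"
  obtains p where "\<And>I n l. profile F I n l \<Longrightarrow> \<forall>i\<in>I. s + 1 \<le> n i \<Longrightarrow> card I < p"
  using assms unfolding many_of_size_def not_ex not_all de_Morgan_conj not_le by blast

lemma many_of_excess_ex:
  assumes "many_of_excess K"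
  shows "enat (K * q) \<le> ex F q"
proof -
  obtain I n l where *: "profile F I n l" "q \<le> card I" "\<forall>i\<in>I. K \<le> l i"
    using assms unfolding many_of_excess_def by blast
  obtain J where J: "J \<subseteq> I" "card J = q"
    using *(2) by (meson obtain_subset_with_card_n)
  have "K * q \<le> (\<Sum>j\<in>J. l j)"
    using J * sum_bounded_below[of J K l] by (auto simp: mult.commute)
  then show ?thesis
    using profile_bouquets[OF *(1) J(1)] J(2) by (metis enat_ord_simps(1) order_trans)
qed

text \<open>Each of \<open>q\<close> components on \<open>s + 1\<close> vertices contributes at
  least the \<open>s\<close> edges of a spanning tree.\<close>

lemma many_of_size_ex:
  assumes "many_of_size s"
  shows "enat (s * q) \<le> ex F (q * (s + 1))"
proof -
  obtain I n l where *: "profile F I n l" "q \<le> card I" "\<forall>i\<in>I. s + 1 \<le> n i"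
    using assms unfolding many_of_size_def by blast
  obtain J where J: "J \<subseteq> I" "card J = q"
    using *(2) by (meson obtain_subset_with_card_n)
  have "profile F J n l"
    using profile_restrict[OF *(1) J(1)] .
  then have "profile F J (\<lambda>_. s + 1) l"
    by (rule profile_contract) (use * J in auto)
  from profile_ex[OF this, of "s * q"] show ?thesis
    using J(2) by (simp add: algebra_simps)
qed

section \<open>The density in each case\<close>

text \<open>For \<open>n\<close> vertices and \<open>c\<close> components there are at most
  \<open>n + (K - 1) c\<close> edges up to a constant, and \<open>c \<le> n\<close> turns this into
  \<open>K n\<close>. Disjoint bouquets attain it.\<close>

lemma limiting_density_many_of_excess:
  assumes N: "N \<ge> 1" "ex F N \<le> enat E" and "K \<ge> 1" and many: "many_of_excess K"
    and few: "\<not> many_of_excess (Suc K)"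
  shows "limiting_density F = ereal (real K)"
proof -
  obtain p where p: "\<And>I n l. profile F I n l \<Longrightarrow> \<forall>i\<in>I. Suc K \<le> l i \<Longrightarrow> card I < p"
    using not_many_of_excess[OF few] by blast
  show ?thesis
  proof (rule limiting_density_eqI[where N = N and C = "real ((p + 1) * E)" and C' = 0])
    fix G assume G: "G \<in> F" "N \<le> card (verts G)"
    obtain I n l where *: "profile F I n l" "card (verts G) = (\<Sum>i\<in>I. n i)"
      "card (edges G) + card I = (\<Sum>i\<in>I. n i) + (\<Sum>i\<in>I. l i)"
      using profile_exists[OF G(1)] by blast
    have "(\<Sum>i\<in>I. l i) \<le> K * card I + (p + 1) * E"
      using excess_bound[OF N p *(1)] G(2) *(2) by simp
    moreover have "card I \<le> card (verts G)"
      using *(2) sum_bounded_below[of I 1 n] profile_pos[OF *(1)] by simp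
    then have "(K - 1) * card I \<le> (K - 1) * card (verts G)"
      by simp
    \<comment> \<open>The split is exact because \<open>K \<ge> 1\<close>; the separate
      \<open>card I\<close> cancels the one in the edge identity.\<close>
    moreover have "K * card I = (K - 1) * card I + card I"
      "K * card (verts G) = (K - 1) * card (verts G) + card (verts G)"
      using \<open>K \<ge> 1\<close> by (simp_all add: algebra_simps)
    ultimately have "card (edges G) \<le> K * card (verts G) + (p + 1) * E"
      using *(2,3) by linarith
    then show "real (card (edges G)) \<le> real K * real (card (verts G)) + real ((p + 1) * E)"
      by (metis of_nat_add of_nat_le_iff of_nat_mult)
  next
    fix q
    show "\<exists>n\<ge>q. \<exists>m. enat m \<le> ex F n \<and> real K * real n - 0 \<le> real m"
      using many_of_excess_ex[OF many, of q] by (intro exI[of _ q]) (auto intro!: exI[of _ "K * q"])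
  qed simp_all
qed

text \<open>The total excess is bounded here, so up to a constant the edges number vertices minus
  components, and the density depends on how large the components can be.\<close>

lemma limiting_density_few_excess:
  assumes N: "N \<ge> 1" "ex F N \<le> enat E" and few: "\<not> many_of_excess 1"
  shows "(\<exists>s::nat. limiting_density F = ereal (real s / real (s + 1))) \<or> limiting_density F = 1"
proof -
  obtain p where p: "\<And>I n l. profile F I n l \<Longrightarrow> \<forall>i\<in>I. Suc 0 \<le> l i \<Longrightarrow> card I < p"
    using not_many_of_excess[OF few] unfolding One_nat_def by blast
  define C where "C = (p + 1) * E"
  have excess: "(\<Sum>i\<in>I. l i) \<le> C" if "profile F I n l" "N \<le> (\<Sum>i\<in>I. n i)" for I n l
    using excess_bound[OF N, of 0 p] p that by (simp add: C_def)
  show ?thesis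
  proof (cases "\<forall>R. \<exists>I n l. profile F I n l \<and> (\<exists>i\<in>I. R \<le> n i)")
    case True
    have "limiting_density F = ereal 1"
    proof (rule limiting_density_eqI[where N = N and C = "real C" and C' = 1])
      fix G assume G: "G \<in> F" "N \<le> card (verts G)"
      obtain I n l where *: "profile F I n l" "card (verts G) = (\<Sum>i\<in>I. n i)"
        "card (edges G) + card I = (\<Sum>i\<in>I. n i) + (\<Sum>i\<in>I. l i)"
        using profile_exists[OF G(1)] by blast
      show "real (card (edges G)) \<le> 1 * real (card (verts G)) + real C"
        using excess[OF *(1)] *(2,3) G(2) by linarith
    next
      fix q
      obtain I n l i where *: "profile F I n l" "i \<in> I" "Suc q \<le> n i"
        using True by blast
      \<comment> \<open>A single component on \<open>q + 1\<close> vertices has at least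
        \<open>q\<close> edges; the difference of one is the constant \<open>C' = 1\<close>.\<close>
      then have "profile F {i} n l"
        using profile_restrict[of I n l "{i}"] by simp
      then have "profile F {i} (\<lambda>_. Suc q) l"
        by (rule profile_contract) (use * in auto)
      from profile_ex[OF this, of q] have "enat q \<le> ex F (Suc q)"
        by simp
      then show "\<exists>n\<ge>q. \<exists>m. enat m \<le> ex F n \<and> 1 * real n - 1 \<le> real m"
        by (intro exI[of _ "Suc q"]) (auto intro!: exI[of _ q])
    qed simp_all
    then show ?thesis by (simp add: one_ereal_def)
  next
    case False
    then obtain R where R: "\<And>I n l i. profile F I n l \<Longrightarrow> i \<in> I \<Longrightarrow> n i \<le> R"
      by (meson nat_le_linear)
    \<comment> \<open>All but fewer than \<open>q\<close> components have at most
      \<open>s + 1\<close> vertices, and the exceptions have at most \<open>R\<close>. Hence, up to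
      a constant, there is at least one component for every \<open>s + 1\<close> vertices.\<close>
    have upper: "real (card (edges G)) \<le> real s / real (s + 1) * real (card (verts G)) + real (q * R + C)"
      if q: "\<And>I n l. profile F I n l \<Longrightarrow> \<forall>i\<in>I. s + 2 \<le> n i \<Longrightarrow> card I < q"
        and G: "G \<in> F" "N \<le> card (verts G)" for G q s
    proof -
      obtain I n l where *: "profile F I n l" "card (verts G) = (\<Sum>i\<in>I. n i)"
        "card (edges G) + card I = (\<Sum>i\<in>I. n i) + (\<Sum>i\<in>I. l i)"
        using profile_exists[OF G(1)] by blast
      have "card {i\<in>I. s + 1 < n i} < q"
        using q[OF profile_restrict[OF *(1), of "{i\<in>I. s + 1 < n i}"]] by auto
      then have "card (verts G) \<le> (s + 1) * card I + q * R"
        unfolding *(2) using R[OF *(1)]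
        by (intro sum_le_few_exceptions[OF profile_finite[OF *(1)]]) auto
      then have "real (card (verts G)) \<le> real ((s + 1) * card I + q * R)"
        by (simp only: of_nat_le_iff)
      then have "real (card (verts G)) / (s + 1) \<le> real ((s + 1) * card I + q * R) / (s + 1)"
        by (intro divide_right_mono) auto
      also have "\<dots> = real (card I) + real (q * R) / (s + 1)"
        unfolding of_nat_add[of "(s + 1) * card I"] of_nat_mult[of "s + 1"] add_divide_distrib
        by simp
      finally have "real (card (verts G)) / (s + 1) \<le> real (card I) + real (q * R) / (s + 1)" .
      moreover have "real (q * R) / (s + 1) \<le> real (q * R)"
        by (simp add: field_simps)
      moreover have "real (card (edges G)) \<le> real (card (verts G)) - real (card I) + real C"
        using excess[OF *(1)] *(2,3) G(2) by linarith
      moreover have "real s / real (s + 1) * real (card (verts G)) =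
          real (card (verts G)) - real (card (verts G)) / (s + 1)"
        by (simp add: field_simps)
      ultimately show ?thesis
        by simp
    qed
    show ?thesis
    proof (cases "many_of_size 0")
      case True
      \<comment> \<open>One component of size at least \<open>s + 1\<close> forces
        \<open>s + 1 \<le> R\<close>, so a greatest such \<open>s\<close> exists.\<close>
      have bound: "s \<le> R" if s: "many_of_size s" for s
      proof -
        obtain I n l where *: "profile F I n l" "1 \<le> card I" "\<forall>i\<in>I. s + 1 \<le> n i"
          using s unfolding many_of_size_def by blast
        then obtain i where "i \<in> I"
          by fastforce
        then show ?thesis
          using R[OF *(1)] *(3) by fastforce
      qed
      define s where "s = (GREATEST s. many_of_size s)"
      have s: "many_of_size s"
        unfolding s_def using True bound by (rule GreatestI_nat)
      have "\<not> many_of_size (s + 1)"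
        using Greatest_le_nat[of many_of_size "s + 1" R] bound by (auto simp: s_def)
      then obtain q where "\<And>I n l. profile F I n l \<Longrightarrow> \<forall>i\<in>I. s + 1 + 1 \<le> n i \<Longrightarrow> card I < q"
        using not_many_of_size by blast
      then have q: "profile F I n l \<Longrightarrow> \<forall>i\<in>I. s + 2 \<le> n i \<Longrightarrow> card I < q" for I n l
        by simp
      have "limiting_density F = ereal (real s / real (s + 1))"
      proof (rule limiting_density_eqI[where N = N and C = "real (q * R + C)" and C' = 0])
        show "\<exists>n\<ge>r. \<exists>m. enat m \<le> ex F n \<and> real s / real (s + 1) * real n - 0 \<le> real m" for r
          using many_of_size_ex[OF s, of r]
          by (intro exI[of _ "r * (s + 1)"]) (auto intro!: exI[of _ "s * r"] simp: field_simps)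
      qed (use upper[OF q] in simp_all)
      then show ?thesis by blast
    next
      case False
      then obtain q where "\<And>I n l. profile F I n l \<Longrightarrow> \<forall>i\<in>I. 0 + 1 \<le> n i \<Longrightarrow> card I < q"
        using not_many_of_size by blast
      \<comment> \<open>Components are nonempty, so \<open>q\<close> bounds the number of all
        components, in particular of those with two or more vertices.\<close>
      then have q: "profile F I n l \<Longrightarrow> \<forall>i\<in>I. 0 + 2 \<le> n i \<Longrightarrow> card I < q" for I n l
        using profile_pos[of I n l] by simp
      \<comment> \<open>Boundedly many components of bounded size give density \<open>0\<close>,
        written as the ratio for \<open>s = 0\<close>. The lower bound \<open>0\<close> also covers
        sizes that no graph in \<open>F\<close> has.\<close>
      have "limiting_density F = ereal (real 0 / real (0 + 1))"
      proof (rule limiting_density_eqI[where N = N and C = "real (q * R + C)" and C' = 0])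
        show "\<exists>n\<ge>r. \<exists>m. enat m \<le> ex F n \<and> real 0 / real (0 + 1) * real n - 0 \<le> real m" for r
          by (intro exI[of _ r] conjI exI[of _ "0 :: nat"]) (simp_all add: zero_enat_def[symmetric])
      qed (use upper[of 0 q] q in simp_all)
      then show ?thesis by blast
    qed
  qed
qed

end

section \<open>Integer, superparticular ratio or infinity\<close>

theorem theorem5:
  fixes F :: "(nat, nat) mgraph set"
  assumes "\<forall>G \<in> F. multigraph G"
    and "minor_closed F"
  shows "(\<exists>k::int. limiting_density F = ereal (real_of_int k)) \<or>
    (\<exists>i::nat. i \<ge> 1 \<and> limiting_density F = ereal (real i / real (i + 1))) \<or>
    limiting_density F = \<infinity>"
proof (cases "limiting_density F = \<infinity>")
  case False
  interpret minor_closed_family F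
    using assms by unfold_locales auto
  obtain N E where N: "N \<ge> 1" "ex F N \<le> enat E"
    using finite_limiting_density_ex[OF False] .
  show ?thesis
  proof (cases "many_of_excess 1")
    case True
    \<comment> \<open>\<open>N\<close> bouquets of \<open>K\<close> loops put \<open>K * N\<close>
      edges on \<open>N\<close> vertices, so \<open>K\<close> is bounded and a greatest one
      exists.\<close>
    have bound: "K \<le> E" if "many_of_excess K" for K
    proof -
      have "K * N \<le> E"
        using many_of_excess_ex[OF that, of N] N(2) by (metis enat_ord_simps(1) order_trans)
      moreover have "K * 1 \<le> K * N"
        using N(1) by (intro mult_le_mono2)
      ultimately show ?thesis
        by linarith
    qed
    define K where "K = (GREATEST K. many_of_excess K)"
    have "many_of_excess K"
      unfolding K_def using True bound by (rule GreatestI_nat)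
    moreover have "K \<ge> 1"
      unfolding K_def using True bound by (rule Greatest_le_nat)
    moreover have "\<not> many_of_excess (Suc K)"
      using Greatest_le_nat[of many_of_excess "Suc K" E] bound by (auto simp: K_def)
    ultimately have "limiting_density F = ereal (real_of_int (int K))"
      using limiting_density_many_of_excess[OF N] by simp
    then show ?thesis by blast
  next
    case False
    then consider s where "limiting_density F = ereal (real s / real (s + 1))" | "limiting_density F = 1"
      using limiting_density_few_excess[OF N] by blast
    then show ?thesis
    proof cases
      case (1 s)
      show ?thesis
      \<comment> \<open>\<open>s = 0\<close> yields the integer \<open>0\<close>, since the ratios
        start at \<open>i = 1\<close>.\<close>
      proof (cases s)
        case 0
        then show ?thesis
          using 1 by (intro disjI1 exI[of _ 0]) simp
      next
        case (Suc j)
        then show ?thesis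
          using 1 by (metis One_nat_def Suc_leI zero_less_Suc)
      qed
    next
      case 2
      then show ?thesis
        by (intro disjI1 exI[of _ 1]) (simp add: one_ereal_def)
    qed
  qed
qed simp

end
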